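(* Let $n\ge 1$ and let $R=(r_1,r_2,\dots,r_n)$ be a vector of positive odd integers. Then there is an $n\times n$ alternating sign matrix whose pattern has row sum vector $R$ if and only if $\mathbf{j}_n\le R\le \mathbf{k}_n$ entrywise.
   Context: An alternating sign matrix (ASM) is an $n\times n$ matrix with entries in $\{0,+1,-1\}$ such that in each row and in each column the nonzero entries alternate in sign, beginning and ending with $+1$. The pattern of $A=[a_{ij}]$ is the $(0,1)$-matrix with a $1$ in position $(i,j)$ if and only if $a_{ij}\ne 0$; its row sum vector is the vector of numbers of nonzero entries in the rows of $A$. The vector $\mathbf{j}_n=(1,\dots,1)$ has $n$ components, and $\mathbf{k}_n=(1,3,5,\dots,5,3,1)$ is the $n$-vector whose $i$-th component is $2\min(i,n+1-i)-1$. *)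

theory Defs
  imports "Jordan_Normal_Form.Matrix"
begin

(* Indices are 0-based, as for all AFP vectors and matrices. *)

(* Entries are required to lie in {0,1,-1} separately, so a sign change between
   consecutive nonzero entries x, y means y = - x. An all-zero vector has no first
   nonzero entry and is excluded. *)
definition alternating_signs :: "int vec \<Rightarrow> bool" where
  "alternating_signs v \<longleftrightarrow>
     (let xs = filter (\<lambda>x. x \<noteq> 0) (list_of_vec v)
      in xs \<noteq> [] \<and> hd xs = 1 \<and> last xs = 1 \<and> successively (\<lambda>x y. y = - x) xs)"

definition alternating_sign_matrix :: "nat \<Rightarrow> int mat \<Rightarrow> bool" where
  "alternating_sign_matrix n A \<longleftrightarrow>
     A \<in> carrier_mat n n \<and>
     (\<forall>i<n. \<forall>j<n. A $$ (i, j) \<in> {0, 1, -1}) \<and>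
     (\<forall>i<n. alternating_signs (row A i)) \<and>
     (\<forall>j<n. alternating_signs (col A j))"

definition pattern :: "int mat \<Rightarrow> int mat" where
  "pattern A = map_mat (\<lambda>x. if x \<noteq> 0 then 1 else 0) A"

definition row_sum_vec :: "int mat \<Rightarrow> int vec" where
  "row_sum_vec P = vec (dim_row P) (\<lambda>i. \<Sum>j<dim_col P. P $$ (i, j))"

definition j_vec :: "nat \<Rightarrow> int vec" where
  "j_vec n = vec n (\<lambda>i. 1)"

(* The 1-based component 2 min(i, n+1-i) - 1 at the shifted index i + 1. *)
definition k_vec :: "nat \<Rightarrow> int vec" where
  "k_vec n = vec n (\<lambda>i. 2 * int (min (i + 1) (n - i)) - 1)"

(* The order on vectors used for j_vec n \<le> R \<le> k_vec n is the entrywise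
   order of the class instance for vec, which also demands equal dimensions. *)

end

theory Submission
  imports Defs
begin

text \<open>
  The sums of the first \<open>i\<close> rows of an alternating sign matrix are \<open>(0,1)\<close>-vectors with \<open>i\<close>
  ones, and a \<open>1\<close> (a \<open>-1\<close>) in a row switches a position of this vector on (off). Row \<open>i\<close>
  therefore has at most \<open>i\<close> and at most \<open>n + 1 - i\<close> entries \<open>1\<close>, which bounds \<open>R\<close>.

  Conversely, start from the set of odd positions as the support after \<open>n div 2\<close> rows and work
  outwards. If no two elements of a set \<open>T\<close> are adjacent and \<open>1 \<le> p \<le> card T\<close>, shift
  the first \<open>p - 1\<close> elements of \<open>T\<close> by one and delete the \<open>p\<close>-th: the result \<open>T'\<close> again
  has no adjacent elements, and the difference of the indicators of \<open>T\<close> and \<open>T'\<close> is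
  an alternating vector with \<open>p\<close> ones. Iterating gives the upper rows; applied to the complements
  of the supports, which start with the even positions, it gives the lower rows.
\<close>

section \<open>Alternating vectors as vectors with partial sums in {0,1}\<close>

text \<open>A two-state automaton whose state \<open>s\<close> is the sum of the entries read so
  far. Zeros leave the state unchanged, so filtering them out makes no difference.\<close>

fun alternating_from :: "int \<Rightarrow> int list \<Rightarrow> bool" where
  "alternating_from s [] \<longleftrightarrow> s = 1"
| "alternating_from s (x # xs) \<longleftrightarrow> s + x \<in> {0, 1} \<and> alternating_from (s + x) xs"

lemma alternating_from_filter:
  "s \<in> {0, 1} \<Longrightarrow> alternating_from s (filter (\<lambda>x. x \<noteq> 0) xs) = alternating_from s xs"
  by (induction xs arbitrary: s) auto

lemma alternating_from_partial_sums:
  "s \<in> {0, 1} \<Longrightarrow> alternating_from s xs \<longleftrightarrow>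
     (\<forall>k\<le>length xs. s + (\<Sum>j<k. xs ! j) \<in> {0, 1}) \<and> s + (\<Sum>j<length xs. xs ! j) = 1"
proof (induction xs arbitrary: s)
  case (Cons x xs)
  have shift: "s + (\<Sum>j<Suc k. (x # xs) ! j) = s + x + (\<Sum>j<k. xs ! j)" for k
    by (simp add: sum.lessThan_Suc_shift del: sum.lessThan_Suc)
  have all: "(\<forall>k\<le>Suc m. P k) \<longleftrightarrow> P 0 \<and> (\<forall>k\<le>m. P (Suc k))" for P and m :: nat
    by (metis Suc_le_mono le0 not0_implies_Suc)
  show ?case
  proof (cases "s + x \<in> {0, 1}")
    case True
    then show ?thesis
      using Cons.IH[OF True] Cons.prems unfolding list.size add_0_right add_Suc_right all shift
      by simp
  next
    case False
    have "\<not> (\<forall>k\<le>length (x # xs). s + (\<Sum>j<k. (x # xs) ! j) \<in> {0, 1})"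
      using False by (auto intro!: exI[of _ 1])
    with False show ?thesis by simp
  qed
qed simp

text \<open>From state \<open>s\<close> the only nonzero entry allowed is \<open>1 - 2 * s\<close>,
  which flips the state. Hence signs alternate, and stopping in state 1 means that the last entry
  read was 1.\<close>

lemma alternating_from_nonzero:
  assumes "set xs \<subseteq> {1, -1}" "s \<in> {0, 1}"
  shows "alternating_from s xs \<longleftrightarrow>
     (if xs = [] then s = 1 else hd xs = 1 - 2 * s \<and> last xs = 1 \<and> successively (\<lambda>x y. y = - x) xs)"
  using assms
proof (induction xs arbitrary: s)
  case (Cons x xs)
  show ?case
  proof (cases "s + x \<in> {0, 1}")
    case True
    have IH: "alternating_from (s + x) xs \<longleftrightarrow> (if xs = [] then s + x = 1
      else hd xs = 1 - 2 * (s + x) \<and> last xs = 1 \<and> successively (\<lambda>x y. y = - x) xs)"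
      using Cons.IH[OF _ True] Cons.prems(1) by simp
    have "s = 0 \<and> x = 1 \<or> s = 1 \<and> x = -1"
      using Cons.prems True by auto
    then show ?thesis
      using IH by (elim disjE conjE; cases xs) (simp_all add: conj_ac)
  next
    case False
    then show ?thesis using Cons.prems by auto
  qed
qed auto

lemma alternating_signs_iff_partial_sums:
  assumes "\<And>j. j < dim_vec v \<Longrightarrow> v $ j \<in> {0, 1, -1}"
  shows "alternating_signs v \<longleftrightarrow>
     (\<forall>k\<le>dim_vec v. (\<Sum>j<k. v $ j) \<in> {0, 1}) \<and> (\<Sum>j<dim_vec v. v $ j) = 1"
proof -
  let ?xs = "list_of_vec v"
  let ?ys = "filter (\<lambda>x. x \<noteq> 0) ?xs"
  have "set ?ys \<subseteq> {1, -1}"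
    using assms by (auto simp: set_list_of_vec vec_set_def)
  then have "alternating_signs v \<longleftrightarrow> alternating_from 0 ?ys"
    unfolding alternating_signs_def Let_def by (subst alternating_from_nonzero) auto
  also have "\<dots> \<longleftrightarrow> alternating_from 0 ?xs"
    by (rule alternating_from_filter) simp
  finally show ?thesis
    by (simp add: alternating_from_partial_sums list_of_vec_index)
qed

section \<open>Necessity of the upper bound\<close>

lemma row_sum_pattern_index:
  assumes "A \<in> carrier_mat n n" "i < n" "\<And>j. j < n \<Longrightarrow> A $$ (i, j) \<in> {0, 1, -1}"
  shows "row_sum_vec (pattern A) $ i = (\<Sum>j<n. \<bar>A $$ (i, j)\<bar>)"
proof -
  have "(\<Sum>j<n. pattern A $$ (i, j)) = (\<Sum>j<n. \<bar>A $$ (i, j)\<bar>)"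
    using assms by (intro sum.cong) (force simp: pattern_def)+
  then show ?thesis
    using assms by (simp add: row_sum_vec_def pattern_def)
qed

lemma asm_row_sum_le:
  assumes asm: "alternating_sign_matrix n A" and i: "i < n"
  shows "row_sum_vec (pattern A) $ i \<le> 2 * int (min (i + 1) (n - i)) - 1"
proof -
  define c where "c k j = (\<Sum>i<k. A $$ (i, j))" for k j
  have A: "A \<in> carrier_mat n n"
    and entries: "\<And>i j. i < n \<Longrightarrow> j < n \<Longrightarrow> A $$ (i, j) \<in> {0, 1, -1}"
    and rows: "\<And>i. i < n \<Longrightarrow> alternating_signs (row A i)"
    and cols: "\<And>j. j < n \<Longrightarrow> alternating_signs (col A j)"
    using asm by (auto simp: alternating_sign_matrix_def)
  have row_sum: "(\<Sum>j<n. A $$ (i, j)) = 1" if "i < n" for i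
    using rows[OF that] A entries that by (subst (asm) alternating_signs_iff_partial_sums) auto
  have c01: "c k j \<in> {0, 1}" if "k \<le> n" "j < n" for k j
  proof -
    have "col A j $ i \<in> {0, 1, -1}" if "i < n" for i
      using A entries that \<open>j < n\<close> by simp
    then have "(\<Sum>i<k. col A j $ i) \<in> {0, 1}"
      using cols[of j] A that alternating_signs_iff_partial_sums[of "col A j"] by simp
    moreover have "(\<Sum>i<k. col A j $ i) = c k j"
      unfolding c_def using A that by (intro sum.cong) auto
    ultimately show ?thesis by simp
  qed
  have c_sum: "(\<Sum>j<n. c k j) = int k" if "k \<le> n" for k
  proof -
    have "(\<Sum>j<n. c k j) = (\<Sum>i<k. \<Sum>j<n. A $$ (i, j))"
      unfolding c_def by (rule sum.swap)
    also have "\<dots> = (\<Sum>i<k. 1)"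
      using that by (intro sum.cong refl row_sum) auto
    finally show ?thesis by simp
  qed
  have step: "c (Suc i) j = c i j + A $$ (i, j)" for j
    by (simp add: c_def)
  \<comment> \<open>Adding the entry to its absolute value gives 2 at an entry 1 and 0 otherwise,
    and an entry 1 forces \<open>c i j = 0\<close> and \<open>c (Suc i) j = 1\<close>.\<close>
  have bounds: "\<bar>A $$ (i, j)\<bar> \<le> 2 * c (Suc i) j - A $$ (i, j)"
    "\<bar>A $$ (i, j)\<bar> \<le> 2 * (1 - c i j) - A $$ (i, j)" if "j < n" for j
    using c01[of i j] c01[of "Suc i" j] entries[OF i that] step[of j] i that by auto
  have "(\<Sum>j<n. \<bar>A $$ (i, j)\<bar>) \<le> (\<Sum>j<n. 2 * c (Suc i) j - A $$ (i, j))"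
    by (intro sum_mono bounds) simp
  also have "\<dots> = 2 * int (Suc i) - 1"
    using i by (simp add: sum_subtractf row_sum c_sum flip: sum_distrib_left)
  finally have 1: "(\<Sum>j<n. \<bar>A $$ (i, j)\<bar>) \<le> 2 * int (Suc i) - 1" .
  have "(\<Sum>j<n. \<bar>A $$ (i, j)\<bar>) \<le> (\<Sum>j<n. 2 * (1 - c i j) - A $$ (i, j))"
    by (intro sum_mono bounds) simp
  also have "\<dots> = 2 * (int n - int i) - 1"
    using i by (simp add: sum_subtractf row_sum c_sum flip: sum_distrib_left)
  finally have 2: "(\<Sum>j<n. \<bar>A $$ (i, j)\<bar>) \<le> 2 * (int n - int i) - 1" .
  show ?thesis
    using 1 2 i by (subst row_sum_pattern_index[OF A i entries[OF i]]) (auto simp: min_def)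
qed

section \<open>Interlacing sets and chains\<close>

text \<open>Prefix counts are used because their differences are the partial sums of the difference
  of the two indicators.\<close>

definition interlaces :: "nat set \<Rightarrow> nat set \<Rightarrow> bool" where
  "interlaces T T' \<longleftrightarrow> (\<forall>x. int (card (T \<inter> {..<x})) - int (card (T' \<inter> {..<x})) \<in> {0, 1})"

definition nonadjacent :: "nat set \<Rightarrow> bool" where
  "nonadjacent T \<longleftrightarrow> (\<forall>x\<in>T. Suc x \<notin> T)"

lemma interlaces_remove_Min:
  assumes "finite T" "\<forall>x\<in>T. a < x"
  shows "interlaces (insert a T) T"
  unfolding interlaces_def using assms by (auto simp: Int_insert_left)

text \<open>The two new elements cancel in every prefix count except at \<open>x = Suc a\<close>,
  where all old elements lie above and the difference is 1.\<close>

lemma interlaces_insert: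
  assumes "finite T" "finite T'" "interlaces T T'" "\<forall>x\<in>T. a < x" "\<forall>x\<in>T'. Suc a < x"
  shows "interlaces (insert a T) (insert (Suc a) T')"
  unfolding interlaces_def
proof
  fix x
  have d: "int (card (T \<inter> {..<x})) - int (card (T' \<inter> {..<x})) \<in> {0, 1}"
    using assms(3) by (simp add: interlaces_def)
  have [simp]: "a \<notin> T" "Suc a \<notin> T'" using assms(4,5) by auto
  show "int (card (insert a T \<inter> {..<x})) - int (card (insert (Suc a) T' \<inter> {..<x})) \<in> {0, 1}"
  proof (cases "x = Suc a")
    case True
    then have "T \<inter> {..<x} = {}" "T' \<inter> {..<x} = {}"
      using assms(4,5) by force+
    then show ?thesis using True by (simp add: Int_insert_left)
  next
    case False
    then show ?thesis using d assms(1,2) by (auto simp: Int_insert_left)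
  qed
qed

text \<open>The last conjunct carries the induction: it leaves room for \<open>Suc a\<close> when a
  new minimum \<open>a\<close> is added to \<open>T\<close>.\<close>

lemma nonadjacent_descent:
  assumes "finite T" "nonadjacent T" "1 \<le> p" "p \<le> card T"
  shows "\<exists>T'. finite T' \<and> nonadjacent T' \<and> Suc (card T') = card T \<and> card (T - T') = p \<and>
    interlaces T T' \<and> (\<forall>y\<in>T'. (\<exists>x\<in>T. x < y) \<and> (\<exists>x\<in>T. y \<le> x))"
  using assms
proof (induction T arbitrary: p rule: finite_linorder_min_induct)
  case empty
  then show ?case by simp
next
  case (insert a T)
  have aT: "a \<notin> T" "Suc a \<notin> T" "nonadjacent T"
    using insert by (auto simp: nonadjacent_def)
  show ?case
  proof (cases "p = 1")
    case True
    have "insert a T - T = {a}" using aT by auto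
    then show ?thesis
      using True insert aT interlaces_remove_Min[of T a] by (intro exI[of _ T]) auto
  next
    \<comment> \<open>The minimum \<open>a\<close> moves to \<open>Suc a\<close>, and the deletion
      of the \<open>p\<close>-th element becomes that of the \<open>(p - 1)\<close>-th element of
      \<open>T\<close>.\<close>
    case False
    then have "1 \<le> p - 1" "p - 1 \<le> card T"
      using insert.prems insert.hyps aT by auto
    then obtain T' where T': "finite T'" "nonadjacent T'" "Suc (card T') = card T"
      "card (T - T') = p - 1" "interlaces T T'"
      and lo: "\<forall>y\<in>T'. \<exists>x\<in>T. x < y" and hi: "\<forall>y\<in>T'. \<exists>x\<in>T. y \<le> x"
      using insert.IH[of "p - 1"] aT by blast
    have gap: "Suc a < x" if "x \<in> T" for x
      using insert.hyps that aT by (metis Suc_lessI)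
    have gap': "Suc (Suc a) < y" if "y \<in> T'" for y
      using lo gap that by (meson Suc_lessI less_trans_Suc not_less_eq order.strict_trans)
    have "interlaces (insert a T) (insert (Suc a) T')"
      using insert.hyps T' gap gap' by (intro interlaces_insert) (auto intro: Suc_lessD)
    moreover have "nonadjacent (insert (Suc a) T')"
      using T'(2) gap' by (force simp: nonadjacent_def)
    moreover have "Suc a \<notin> T'" "a \<notin> T'" using gap' by force+
    moreover from this have "insert a T - insert (Suc a) T' = insert a (T - T')"
      using aT by auto
    \<comment> \<open>Some element of \<open>T\<close> bounds \<open>Suc a\<close> from above, so
      shifting never leaves the range of the original set.\<close>
    moreover obtain b where "b \<in> T" "Suc a \<le> b"
      using T'(3) gap by (metis card.empty ex_in_conv less_imp_le nat.distinct(1))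
    ultimately show ?thesis
      using T' aT insert.hyps insert.prems lo hi
      by (intro exI[of _ "insert (Suc a) T'"]) auto
  qed
qed

text \<open>Each step of the chain will be a matrix row, with \<open>q i\<close> the number of its
  entries 1.\<close>

definition interlacing_chain :: "nat \<Rightarrow> nat \<Rightarrow> (nat \<Rightarrow> nat) \<Rightarrow> (nat \<Rightarrow> nat set) \<Rightarrow> bool" where
  "interlacing_chain n m q f \<longleftrightarrow> (\<forall>i<m. f i \<subseteq> {..<n} \<and> f (Suc i) \<subseteq> {..<n} \<and>
    card (f (Suc i)) = Suc (card (f i)) \<and> card (f (Suc i) - f i) = q i \<and>
    interlaces (f (Suc i)) (f i))"

text \<open>The chain is built downwards from \<open>T\<close> by repeated descent; the bound
  \<open>q i \<le> Suc i\<close> is what the descent needs, as the larger set of step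
  \<open>i\<close> has \<open>Suc i\<close> elements.\<close>

lemma nonadjacent_chain:
  assumes "T \<subseteq> {..<n}" "nonadjacent T" "card T = m" "\<And>i. i < m \<Longrightarrow> 1 \<le> q i \<and> q i \<le> Suc i"
  shows "\<exists>f. f 0 = {} \<and> f m = T \<and> interlacing_chain n m q f"
  using assms
proof (induction m arbitrary: T)
  case 0
  then have "T = {}" by (metis card_0_eq finite_lessThan finite_subset)
  then show ?case by (auto simp: interlacing_chain_def)
next
  case (Suc m)
  have "finite T" using Suc.prems(1) finite_subset by blast
  then obtain T' where T': "nonadjacent T'" "Suc (card T') = card T" "card (T - T') = q m"
    "interlaces T T'" "\<forall>y\<in>T'. \<exists>x\<in>T. y \<le> x"
    using nonadjacent_descent[of T "q m"] Suc.prems by auto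
  then have sub: "T' \<subseteq> {..<n}" using Suc.prems(1) by fastforce
  obtain f where f: "f 0 = {}" "f m = T'" "interlacing_chain n m q f"
    using Suc.IH[of T'] T' sub Suc.prems by auto
  show ?case
    using f T' sub Suc.prems(1) by (intro exI[of _ "f(Suc m := T)"]) (auto simp: interlacing_chain_def less_Suc_eq)
qed

section \<open>Indicator differences as rows, and assembly of the matrix\<close>

lemma sum_of_bool_mem_lessThan:
  fixes T :: "nat set"
  shows "(\<Sum>j<x. of_bool (j \<in> T)) = int (card (T \<inter> {..<x}))"
  by (induction x) (simp_all add: lessThan_Suc Int_insert_right)

lemma interlaces_sum:
  assumes "interlaces T T'"
  shows "(\<Sum>j<x. of_bool (j \<in> T) - of_bool (j \<in> T')) \<in> {0, 1 :: int}"
  using assms by (simp only: interlaces_def sum_subtractf sum_of_bool_mem_lessThan)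

lemma sum_diff_of_bool:
  fixes T T' :: "nat set"
  assumes "T \<subseteq> {..<n}" "T' \<subseteq> {..<n}" "card T = Suc (card T')"
  shows "(\<Sum>j<n. of_bool (j \<in> T) - of_bool (j \<in> T')) = (1 :: int)"
  using assms by (simp only: sum_subtractf sum_of_bool_mem_lessThan Int_absorb2)

text \<open>Each entry 1 contributes 2 to the sum of absolute value and entry, and the entries
  themselves sum to 1.\<close>

lemma sum_abs_diff_of_bool:
  fixes T T' :: "nat set"
  assumes "T \<subseteq> {..<n}" "T' \<subseteq> {..<n}" "card T = Suc (card T')"
  shows "(\<Sum>j<n. \<bar>of_bool (j \<in> T) - of_bool (j \<in> T')\<bar>) = 2 * int (card (T - T')) - 1"
proof -
  have "(\<Sum>j<n. \<bar>of_bool (j \<in> T) - of_bool (j \<in> T')\<bar>) =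
    (\<Sum>j<n. 2 * of_bool (j \<in> T - T') - (of_bool (j \<in> T) - of_bool (j \<in> T')) :: int)"
    by (intro sum.cong) auto
  also have "\<dots> = 2 * (\<Sum>j<n. of_bool (j \<in> T - T'))
      - (\<Sum>j<n. of_bool (j \<in> T) - of_bool (j \<in> T'))"
    by (simp only: sum_subtractf sum_distrib_left)
  also have "\<dots> = 2 * int (card ((T - T') \<inter> {..<n})) - 1"
    by (simp only: sum_diff_of_bool[OF assms] sum_of_bool_mem_lessThan)
  also have "(T - T') \<inter> {..<n} = T - T'"
    using assms by auto
  finally show ?thesis .
qed

lemma card_odd_lessThan: "card {j. j < n \<and> odd j} = n div 2"
proof (induction n)
  case (Suc n)
  have "{j. j < Suc n \<and> odd j} = (if odd n then insert n else id) {j. j < n \<and> odd j}"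
    by (auto simp: less_Suc_eq)
  then show ?case using Suc by auto
qed simp

lemma card_even_lessThan: "card {j. j < n \<and> even j} = n - n div 2"
proof -
  have "{j. j < n \<and> even j} = {..<n} - {j. j < n \<and> odd j}" by auto
  then show ?thesis
    by (simp add: card_Diff_subset card_odd_lessThan subset_iff)
qed

text \<open>In a matrix of differences \<open>c (i + 1) j - c i j\<close> the column sums telescope, so only
  the rows have to be checked.\<close>

lemma asm_of_column_sums:
  fixes c :: "nat \<Rightarrow> nat \<Rightarrow> int"
  assumes c01: "\<And>i j. i \<le> n \<Longrightarrow> j < n \<Longrightarrow> c i j \<in> {0, 1}"
    and c0: "\<And>j. j < n \<Longrightarrow> c 0 j = 0" and cn: "\<And>j. j < n \<Longrightarrow> c n j = 1"
    and partial: "\<And>i x. i < n \<Longrightarrow> x \<le> n \<Longrightarrow> (\<Sum>j<x. c (Suc i) j - c i j) \<in> {0, 1}"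
    and total: "\<And>i. i < n \<Longrightarrow> (\<Sum>j<n. c (Suc i) j - c i j) = 1"
  shows "alternating_sign_matrix n (mat n n (\<lambda>(i, j). c (Suc i) j - c i j))"
    (is "alternating_sign_matrix n ?A")
proof -
  have entry: "?A $$ (i, j) \<in> {0, 1, -1}" if "i < n" "j < n" for i j
    using c01[of i j] c01[of "Suc i" j] that by auto
  have "alternating_signs (row ?A i)" if i: "i < n" for i
  proof -
    have "(\<Sum>j<x. row ?A i $ j) = (\<Sum>j<x. c (Suc i) j - c i j)" if "x \<le> n" for x
      using i that by (intro sum.cong) auto
    then show ?thesis
      using i partial[OF i] total[OF i] entry[OF i]
      by (subst alternating_signs_iff_partial_sums) auto
  qed
  moreover have "alternating_signs (col ?A j)" if j: "j < n" for j
  proof -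
    have "(\<Sum>i<x. col ?A j $ i) = c x j" if "x \<le> n" for x
    proof -
      have "(\<Sum>i<x. col ?A j $ i) = (\<Sum>i<x. c (Suc i) j - c i j)"
        using j that by (intro sum.cong) auto
      also have "\<dots> = c x j"
        using c0[OF j] sum_lessThan_telescope[of "\<lambda>i. c i j" x] by simp
      finally show ?thesis .
    qed
    then show ?thesis
      using j c01 cn[OF j] entry
      by (subst alternating_signs_iff_partial_sums) auto
  qed
  ultimately show ?thesis
    using entry by (auto simp: alternating_sign_matrix_def)
qed

lemma asm_with_row_sums_exists:
  assumes "\<And>i. i < n \<Longrightarrow> 1 \<le> p i \<and> p i \<le> min (Suc i) (n - i)"
  shows "\<exists>A. alternating_sign_matrix n A \<and>
    row_sum_vec (pattern A) = vec n (\<lambda>i. 2 * int (p i) - 1)"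
proof -
  define k where "k = n div 2"
  have odds: "{j. j < n \<and> odd j} \<subseteq> {..<n}" "nonadjacent {j. j < n \<and> odd j}"
    "card {j. j < n \<and> odd j} = k"
    and evens: "{j. j < n \<and> even j} \<subseteq> {..<n}" "nonadjacent {j. j < n \<and> even j}"
    "card {j. j < n \<and> even j} = n - k"
    by (auto simp: nonadjacent_def card_odd_lessThan card_even_lessThan k_def)
  have upper_p: "1 \<le> p i \<and> p i \<le> Suc i" if "i < k" for i
    using assms[of i] that by (simp add: k_def)
  \<comment> \<open>The lower rows are numbered from the bottom: for row \<open>n - Suc i\<close>
    the bound \<open>n - (n - Suc i)\<close> is \<open>Suc i\<close>.\<close>
  have lower_p: "1 \<le> p (n - Suc i) \<and> p (n - Suc i) \<le> Suc i" if "i < n - k" for i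
    using assms[of "n - Suc i"] that by (auto simp: min_def split: if_splits)
  obtain f where f: "f 0 = {}" "f k = {j. j < n \<and> odd j}"
    "interlacing_chain n k p f"
    using nonadjacent_chain[where q = p, OF odds upper_p] by blast
  obtain g where g: "g 0 = {}" "g (n - k) = {j. j < n \<and> even j}"
    "interlacing_chain n (n - k) (\<lambda>i. p (n - Suc i)) g"
    using nonadjacent_chain[where q = "\<lambda>i. p (n - Suc i)", OF evens lower_p] by blast
  define c :: "nat \<Rightarrow> nat \<Rightarrow> int" where
    "c i j = (if i \<le> k then of_bool (j \<in> f i) else 1 - of_bool (j \<in> g (n - i)))" for i j
  define A where "A = mat n n (\<lambda>(i, j). c (Suc i) j - c i j)"
  \<comment> \<open>Both branches agree at \<open>i = k\<close>, since the odd and the even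
    positions below \<open>n\<close> are complementary.\<close>
  have lower: "c i j = 1 - of_bool (j \<in> g (n - i))" if "k \<le> i" "j < n" for i j
    using that f(2) g(2) by (cases "i = k") (auto simp: c_def)
  have rows: "\<exists>T T'. T \<subseteq> {..<n} \<and> T' \<subseteq> {..<n} \<and> card T = Suc (card T') \<and>
    card (T - T') = p i \<and> interlaces T T' \<and>
    (\<forall>j<n. c (Suc i) j - c i j = of_bool (j \<in> T) - of_bool (j \<in> T'))" if "i < n" for i
  proof (cases "i < k")
    case True
    then show ?thesis
      using f(3) by (intro exI[of _ "f (Suc i)"] exI[of _ "f i"]) (simp add: c_def interlacing_chain_def)
  next
    case False
    \<comment> \<open>Complementing and reversing the chain \<open>g\<close> cancel each other's
      sign, so the row is again the larger indicator minus the smaller.\<close>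
    define m where "m = n - Suc i"
    have m: "m < n - k" "n - i = Suc m" "n - Suc m = i" "n - Suc i = m"
      using False that by (auto simp: m_def)
    then show ?thesis
      using g(3) False lower[of i] lower[of "Suc i"]
      by (intro exI[of _ "g (Suc m)"] exI[of _ "g m"]) (auto simp: interlacing_chain_def)
  qed
  have asm: "alternating_sign_matrix n A"
    unfolding A_def
  proof (rule asm_of_column_sums)
    show "c i j \<in> {0, 1}" for i j by (simp add: c_def)
    show "c 0 j = 0" for j by (simp add: c_def f(1))
    show "c n j = 1" if "j < n" for j
      using lower[of n j] that g(1) by (simp add: k_def)
  next
    fix i x assume "i < n" "x \<le> n"
    then obtain T T' where "interlaces T T'"
      and "\<forall>j<n. c (Suc i) j - c i j = of_bool (j \<in> T) - of_bool (j \<in> T')"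
      using rows by meson
    then show "(\<Sum>j<x. c (Suc i) j - c i j) \<in> {0, 1}"
      using interlaces_sum[of T T' x] \<open>x \<le> n\<close>
      by (metis (no_types, lifting) lessThan_iff order.strict_trans2 sum.cong)
  next
    fix i assume "i < n"
    then obtain T T' where "T \<subseteq> {..<n}" "T' \<subseteq> {..<n}" "card T = Suc (card T')"
      and "\<forall>j<n. c (Suc i) j - c i j = of_bool (j \<in> T) - of_bool (j \<in> T')"
      using rows by meson
    then show "(\<Sum>j<n. c (Suc i) j - c i j) = 1"
      using sum_diff_of_bool[of T n T'] by simp
  qed
  have "row_sum_vec (pattern A) $ i = 2 * int (p i) - 1" if i: "i < n" for i
  proof -
    obtain T T' where T: "T \<subseteq> {..<n}" "T' \<subseteq> {..<n}" "card T = Suc (card T')"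
      "card (T - T') = p i"
      and "\<forall>j<n. c (Suc i) j - c i j = of_bool (j \<in> T) - of_bool (j \<in> T')"
      using rows[OF i] by meson
    then have "(\<Sum>j<n. \<bar>A $$ (i, j)\<bar>) = 2 * int (p i) - 1"
      using sum_abs_diff_of_bool[OF T(1-3)] i by (simp add: A_def)
    then show ?thesis
      using asm i by (subst row_sum_pattern_index[of A n i]) (auto simp: alternating_sign_matrix_def)
  qed
  then have "row_sum_vec (pattern A) = vec n (\<lambda>i. 2 * int (p i) - 1)"
    by (intro eq_vecI) (auto simp: row_sum_vec_def pattern_def A_def)
  with asm show ?thesis by blast
qed

theorem theorem2p2:
  fixes n :: nat and R :: "int vec"
  assumes "n \<ge> 1"
    and "R \<in> carrier_vec n"
    and "\<forall>i<n. R $ i > 0 \<and> odd (R $ i)"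
  shows "(\<exists>A. alternating_sign_matrix n A \<and> row_sum_vec (pattern A) = R)
     \<longleftrightarrow> j_vec n \<le> R \<and> R \<le> k_vec n"
proof
  assume "\<exists>A. alternating_sign_matrix n A \<and> row_sum_vec (pattern A) = R"
  then show "j_vec n \<le> R \<and> R \<le> k_vec n"
    using asm_row_sum_le assms by (force simp: less_eq_vec_def j_vec_def k_vec_def)
next
  assume bounds: "j_vec n \<le> R \<and> R \<le> k_vec n"
  \<comment> \<open>A row with sum 1 and \<open>R $ i\<close> nonzero entries has
    \<open>(R $ i + 1) div 2\<close> entries 1.\<close>
  define p where "p i = nat ((R $ i + 1) div 2)" for i
  have R: "R $ i = 2 * int (p i) - 1 \<and> 1 \<le> p i \<and> p i \<le> min (Suc i) (n - i)" if "i < n" for i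
  proof -
    have "R $ i \<le> 2 * int (min (Suc i) (n - i)) - 1" "R $ i > 0" "odd (R $ i)"
      using bounds assms that by (auto simp: less_eq_vec_def k_vec_def)
    moreover from this obtain m where "R $ i = 2 * m + 1"
      by (elim oddE)
    ultimately show ?thesis by (auto simp: p_def min_def split: if_splits)
  qed
  then obtain A where "alternating_sign_matrix n A"
    "row_sum_vec (pattern A) = vec n (\<lambda>i. 2 * int (p i) - 1)"
    using asm_with_row_sums_exists[of n p] by blast
  moreover have "vec n (\<lambda>i. 2 * int (p i) - 1) = R"
    using R assms(2) by (intro eq_vecI) auto
  ultimately show "\<exists>A. alternating_sign_matrix n A \<and> row_sum_vec (pattern A) = R"
    by auto
qed

end
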